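(* Let $\mathcal{K}\subseteq\mathbb{R}^d$ be a nonempty closed convex set, let $f_1,\dots,f_n:\mathbb{R}^d\to\mathbb{R}$ be convex and differentiable with $L$-Lipschitz continuous gradients ($L>0$), let $f=\frac1n\sum_{i=1}^n f_i$, and let $x^\star\in\arg\min_{x\in\mathcal{K}}f(x)$. Assume that $f$ has cone-restricted strong convexity parameter $\mu_c>0$ (defined in the context). Let $(x^k,\{\phi_i^k\}_{i=1}^n)_{k\ge 0}$ be generated by the SAGA algorithm for constrained minimization (described in the context) with step size $\gamma=\frac{1}{6L}$, and set $c=\frac{1}{\gamma(1+4\mu_c\gamma)n}$. Define $$\mathcal{T}^k:=\frac1n\sum_{i=1}^n f_i(\phi_i^k)-f(x^\star)-\frac1n\sum_{i=1}^n\langle\nabla f_i(x^\star),\phi_i^k-x^\star\rangle+c\|x^k-x^\star\|_2^2 .$$ Then for every $k\ge 0$, $$\mathbb{E}(\mathcal{T}^{k+1})\le\left[1-\min\left(\frac{1}{2n},\frac{\mu_c}{6L}\right)\right]\mathcal{T}^k,$$ where the expectation is over the random index drawn at iteration $k$, conditionally on $x^k$ and $\{\phi_i^k\}_{i=1}^n$.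
   Context: Cone-restricted strong convexity: $\mu_c$ is the largest positive constant such that for all $x\in\mathcal{K}$ both $$f(x)-f(x^\star)-\langle\nabla f(x^\star),x-x^\star\rangle\ge\frac{\mu_c}{2}\|x-x^\star\|_2^2\quad\text{and}\quad f(x^\star)-f(x)-\langle\nabla f(x),x^\star-x\rangle\ge\frac{\mu_c}{2}\|x-x^\star\|_2^2 .$$ SAGA for constrained minimization, step size $\gamma$: start from $x^0\in\mathcal{K}$ with $\phi_i^0=x^0$ for all $i$. At iteration $k=0,1,2,\dots$: draw $j\in\{1,\dots,n\}$ uniformly at random (independently of the past); set $\phi_j^{k+1}=x^k$ and $\phi_i^{k+1}=\phi_i^k$ for $i\ne j$; compute $$w^{k+1}=x^k-\gamma\left[\nabla f_j(\phi_j^{k+1})-\nabla f_j(\phi_j^k)+\frac1n\sum_{i=1}^n\nabla f_i(\phi_i^k)\right],\qquad x^{k+1}=\mathcal{P}_{\mathcal{K}}(w^{k+1}):=\arg\min_{u\in\mathcal{K}}\|u-w^{k+1}\|_2^2 .$$ *)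

theory Defs
  imports "HOL-Probability.Probability"
begin

definition gradient :: "('a::real_inner \<Rightarrow> real) \<Rightarrow> 'a \<Rightarrow> 'a" where
  "gradient g x = (THE D. GDERIV g x :> D)"

lemma GDERIV_unique:
  assumes "GDERIV g x :> D" "GDERIV g x :> D'"
  shows "D = D'"
proof -
  have "(\<lambda>h. inner h D) = (\<lambda>h. inner h D')"
    using assms unfolding gderiv_def by (rule has_derivative_unique)
  then have "inner (D - D') D = inner (D - D') D'"
    by (rule fun_cong)
  then have "inner (D - D') (D - D') = 0"
    by (simp add: inner_diff_right)
  then show ?thesis
    by simp
qed

lemma gradient_eq: "GDERIV g x :> D \<Longrightarrow> gradient g x = D"
  unfolding gradient_def by (blast intro: the_equality GDERIV_unique)

lemma GDERIV_gradient:
  fixes g :: "'a::euclidean_space \<Rightarrow> real"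
  assumes "g differentiable (at x)"
  shows "GDERIV g x :> gradient g x"
proof -
  obtain g' where g': "(g has_derivative g') (at x)"
    using assms unfolding differentiable_def by blast
  then have lin: "linear g'"
    by (rule has_derivative_linear)
  have "g' h = inner h (adjoint g' 1)" for h
    using adjoint_works[OF lin, of h 1] by simp
  then have "GDERIV g x :> adjoint g' 1"
    using g' unfolding gderiv_def by (metis (no_types, lifting) ext)
  then show ?thesis
    using gradient_eq by metis
qed

definition average :: "nat \<Rightarrow> (nat \<Rightarrow> 'a \<Rightarrow> real) \<Rightarrow> 'a \<Rightarrow> real" where
  "average n f x = (1 / real n) * (\<Sum>i\<in>{1..n}. f i x)"

definition cone_strong_convexity_const ::
    "'a::real_inner set \<Rightarrow> ('a \<Rightarrow> real) \<Rightarrow> 'a \<Rightarrow> real \<Rightarrow> bool" where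
  "cone_strong_convexity_const K g xs m \<longleftrightarrow> 0 < m \<and>
     (\<forall>x\<in>K.
        g x - g xs - inner (gradient g xs) (x - xs) \<ge> m / 2 * (norm (x - xs))\<^sup>2 \<and>
        g xs - g x - inner (gradient g x) (xs - x) \<ge> m / 2 * (norm (x - xs))\<^sup>2)"

text \<open>
  The parameter is the largest admissible constant.  For \<open>K = {xs}\<close> every positive
  number is admissible, so that there is no largest one and the predicate is false.
\<close>

definition cone_strong_convexity_parameter ::
    "'a::real_inner set \<Rightarrow> ('a \<Rightarrow> real) \<Rightarrow> 'a \<Rightarrow> real \<Rightarrow> bool" where
  "cone_strong_convexity_parameter K g xs m \<longleftrightarrow>
     cone_strong_convexity_const K g xs m \<and>
     (\<forall>m'. cone_strong_convexity_const K g xs m' \<longrightarrow> m' \<le> m)"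

text \<open>
  A single trajectory of SAGA driven by the index sequence \<open>j\<close>, where \<open>j k\<close> is the index
  drawn at iteration \<open>k\<close>; the table entry \<open>\<phi> k i\<close> is relevant for \<open>i \<in> {1..n}\<close> only.
  For nonempty closed convex \<open>K\<close>, \<^const>\<open>closest_point\<close> is the Euclidean projection.
\<close>

definition saga_trajectory ::
    "'a::{real_inner,heine_borel} set \<Rightarrow> nat \<Rightarrow> (nat \<Rightarrow> 'a \<Rightarrow> real) \<Rightarrow> real \<Rightarrow> 'a \<Rightarrow>
     (nat \<Rightarrow> nat) \<Rightarrow> (nat \<Rightarrow> 'a) \<Rightarrow> (nat \<Rightarrow> nat \<Rightarrow> 'a) \<Rightarrow> bool" where
  "saga_trajectory K n f \<gamma> x0 j x \<phi> \<longleftrightarrow>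
     x 0 = x0 \<and> (\<forall>i\<in>{1..n}. \<phi> 0 i = x0) \<and>
     (\<forall>k. \<phi> (Suc k) (j k) = x k \<and>
          (\<forall>i\<in>{1..n} - {j k}. \<phi> (Suc k) i = \<phi> k i) \<and>
          x (Suc k) = closest_point K
            (x k - \<gamma> *\<^sub>R (gradient (f (j k)) (\<phi> (Suc k) (j k)) - gradient (f (j k)) (\<phi> k (j k))
                          + (1 / real n) *\<^sub>R (\<Sum>i\<in>{1..n}. gradient (f i) (\<phi> k i)))))"

definition saga_lyapunov ::
    "nat \<Rightarrow> (nat \<Rightarrow> 'a::real_inner \<Rightarrow> real) \<Rightarrow> 'a \<Rightarrow> real \<Rightarrow> 'a \<Rightarrow> (nat \<Rightarrow> 'a) \<Rightarrow> real" where
  "saga_lyapunov n f xs c x \<phi> =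
     (1 / real n) * (\<Sum>i\<in>{1..n}. f i (\<phi> i)) - average n f xs
     - (1 / real n) * (\<Sum>i\<in>{1..n}. inner (gradient (f i) xs) (\<phi> i - xs))
     + c * (norm (x - xs))\<^sup>2"

text \<open>The sigma-algebra on \<open>space M\<close> generated by \<open>x\<close> and \<open>\<phi> 1, \<dots>, \<phi> n\<close>.\<close>

definition saga_sigma ::
    "'w measure \<Rightarrow> nat \<Rightarrow> ('w \<Rightarrow> 'a::topological_space) \<Rightarrow> (nat \<Rightarrow> 'w \<Rightarrow> 'a) \<Rightarrow> 'w measure" where
  "saga_sigma M n x \<phi> =
     vimage_algebra (space M) (\<lambda>\<omega>. (x \<omega>, \<lambda>i\<in>{1..n}. \<phi> i \<omega>))
       (borel \<Otimes>\<^sub>M (\<Pi>\<^sub>M i\<in>{1..n}. borel))"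

end

theory Submission
  imports Defs
begin

text \<open>
  The search direction for the index \<open>j\<close> minus \<open>\<nabla>f(x\<^sup>\<star>)\<close> is \<open>a\<^sub>j - (b\<^sub>j - mean b)\<close> with
  \<open>a\<^sub>j = \<nabla>f\<^sub>j(x) - \<nabla>f\<^sub>j(x\<^sup>\<star>)\<close> and \<open>b\<^sub>j = \<nabla>f\<^sub>j(\<phi>\<^sub>j) - \<nabla>f\<^sub>j(x\<^sup>\<star>)\<close>.  As \<open>x\<^sup>\<star>\<close> is a fixed point of the
  projected gradient step and projections are nonexpansive, the mean of the next squared distance to
  \<open>x\<^sup>\<star>\<close> is controlled by the mean square of these vectors, which a variance decomposition and Young's
  inequality bound by \<open>3 mean \<parallel>a\<parallel>\<^sup>2 + (3/2) mean \<parallel>b\<parallel>\<^sup>2 - 2 \<parallel>mean a\<parallel>\<^sup>2\<close>.  By cocoercivity the first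
  term is at most \<open>6 L B\<close>, with \<open>B\<close> the Bregman divergence of \<open>f\<close> at \<open>(x\<^sup>\<star>, x)\<close>, and the second at
  most \<open>3 L\<close> times the table part of the Lyapunov function.  The negative term cannot be dropped: with
  \<open>A\<close> the Bregman divergence at \<open>(x, x\<^sup>\<star>)\<close>, strong convexity and Cauchy-Schwarz give
  \<open>\<parallel>mean a\<parallel>\<^sup>2 \<ge> \<mu> (A + B)\<close>, which is exactly what \<open>A, B \<ge> \<mu> / 2 \<parallel>x - x\<^sup>\<star>\<parallel>\<^sup>2\<close> needs to close the
  estimate.  Conditional expectation reduces to the mean over \<open>j\<close> because the state at time \<open>k\<close> is a
  function of the indices drawn before time \<open>k\<close>.
\<close>

section \<open>Smooth convex functions\<close>

definition bregman :: "('a::real_inner \<Rightarrow> real) \<Rightarrow> 'a \<Rightarrow> 'a \<Rightarrow> real" where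
  "bregman g y x = g y - g x - inner (gradient g x) (y - x)"

lemma has_real_derivative_along_line:
  fixes g :: "'a::euclidean_space \<Rightarrow> real"
  assumes "g differentiable (at (x + t *\<^sub>R d))"
  shows "((\<lambda>t. g (x + t *\<^sub>R d)) has_real_derivative inner (gradient g (x + t *\<^sub>R d)) d) (at t)"
proof -
  have "((\<lambda>t. x + t *\<^sub>R d) has_derivative (\<lambda>h. h *\<^sub>R d)) (at t)"
    by (auto intro!: derivative_eq_intros)
  moreover have "(g has_derivative (\<lambda>h. inner h (gradient g (x + t *\<^sub>R d)))) (at (x + t *\<^sub>R d))"
    using GDERIV_gradient[OF assms] unfolding gderiv_def .
  ultimately have "((\<lambda>t. g (x + t *\<^sub>R d)) has_derivative
      (\<lambda>h. inner (h *\<^sub>R d) (gradient g (x + t *\<^sub>R d)))) (at t)"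
    by (rule has_derivative_compose)
  then show ?thesis
    by (simp add: has_field_derivative_def inner_commute mult.commute[of _ "inner _ _"])
qed

text \<open>Restricting \<open>g\<close> to the line through \<open>x\<close> and \<open>y\<close>
  reduces the claim to a convex function of one real variable lying above its tangent at
  \<open>0\<close>.\<close>

lemma bregman_nonneg:
  fixes g :: "'a::euclidean_space \<Rightarrow> real"
  assumes conv: "convex_on UNIV g" and diff: "\<And>z. g differentiable (at z)"
  shows "bregman g y x \<ge> 0"
proof -
  define h where "h = (\<lambda>t. g (x + t *\<^sub>R (y - x)))"
  have conv_h: "convex_on UNIV h"
  proof (rule convex_onI)
    fix t a b :: real
    assume t: "0 < t" "t < 1"
    have "x + ((1 - t) *\<^sub>R a + t *\<^sub>R b) *\<^sub>R (y - x)
        = (1 - t) *\<^sub>R (x + a *\<^sub>R (y - x)) + t *\<^sub>R (x + b *\<^sub>R (y - x))"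
      by (simp add: algebra_simps)
    then show "h ((1 - t) *\<^sub>R a + t *\<^sub>R b) \<le> (1 - t) * h a + t * h b"
      using convex_onD[OF conv, of t] t by (simp add: h_def)
  qed simp
  have "(h has_real_derivative inner (gradient g x) (y - x)) (at 0)"
    using has_real_derivative_along_line[OF diff, of x "y - x" 0] by (simp add: h_def)
  then have "h 1 - h 0 \<ge> inner (gradient g x) (y - x) * (1 - 0)"
    by (intro convex_on_imp_above_tangent[OF conv_h]) (auto simp: DERIV_subset)
  then show ?thesis
    by (simp add: h_def bregman_def)
qed

lemma bregman_le_quadratic:
  fixes g :: "'a::euclidean_space \<Rightarrow> real"
  assumes diff: "\<And>z. g differentiable (at z)" and lip: "L-lipschitz_on UNIV (gradient g)"
  shows "bregman g y x \<le> L / 2 * (norm (y - x))\<^sup>2"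
proof -
  define d where "d = y - x"
  \<comment> \<open>The correction terms are chosen so that \<open>h 1 \<le> h 0\<close> is the
    claim; the Lipschitz bound makes the derivative of \<open>h\<close> nonpositive on the unit
    interval.\<close>
  define h where "h = (\<lambda>t. g (x + t *\<^sub>R d) - t * inner (gradient g x) d - L / 2 * t\<^sup>2 * (norm d)\<^sup>2)"
  have "h 1 \<le> h 0"
  proof (rule DERIV_nonpos_imp_nonincreasing[where a = 0 and b = 1])
    fix t :: real
    assume t: "0 \<le> t" "t \<le> 1"
    have "(h has_real_derivative
        inner (gradient g (x + t *\<^sub>R d)) d - inner (gradient g x) d - L * t * (norm d)\<^sup>2) (at t)"
      unfolding h_def
      by (rule derivative_eq_intros has_real_derivative_along_line[OF diff] refl | simp)+
    moreover have "inner (gradient g (x + t *\<^sub>R d) - gradient g x) d \<le> L * t * (norm d)\<^sup>2"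
    proof -
      have "inner (gradient g (x + t *\<^sub>R d) - gradient g x) d
          \<le> norm (gradient g (x + t *\<^sub>R d) - gradient g x) * norm d"
        by (rule norm_cauchy_schwarz)
      also have "\<dots> \<le> (L * norm (t *\<^sub>R d)) * norm d"
        using lipschitz_onD[OF lip, of "x + t *\<^sub>R d" x]
        by (intro mult_right_mono) (simp_all add: dist_norm)
      finally show ?thesis
        using t by (simp add: power2_eq_square mult_ac)
    qed
    ultimately show "\<exists>D. (h has_real_derivative D) (at t) \<and> D \<le> 0"
      by (auto simp: inner_diff_left)
  qed simp
  then show ?thesis
    by (simp add: h_def bregman_def d_def)
qed

text \<open>Subtracting from \<open>g\<close> its linearisation at \<open>x\<close> leaves a
  nonnegative function. By \<open>bregman_le_quadratic\<close>, a gradient step of length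
  \<open>1 / L\<close> from \<open>y\<close> lowers it by at least the squared gradient difference
  over \<open>2 * L\<close>, so its value at \<open>y\<close> is at least that large.\<close>

lemma norm_gradient_diff_le_bregman:
  fixes g :: "'a::euclidean_space \<Rightarrow> real"
  assumes conv: "convex_on UNIV g" and diff: "\<And>z. g differentiable (at z)"
    and lip: "L-lipschitz_on UNIV (gradient g)" and L: "L > 0"
  shows "(norm (gradient g y - gradient g x))\<^sup>2 \<le> 2 * L * bregman g y x"
proof -
  define p where "p = gradient g y - gradient g x"
  define z where "z = y - (1 / L) *\<^sub>R p"
  have zy: "z - y = - (1 / L) *\<^sub>R p" and zx: "z - x = (y - x) - (1 / L) *\<^sub>R p"
    by (simp_all add: z_def)
  have "0 \<le> bregman g z x"
    by (rule bregman_nonneg[OF conv diff])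
  \<comment> \<open>Three-point identity for Bregman divergences; its cross term is the inner
    product of \<open>p\<close> with \<open>z - y\<close>.\<close>
  also have "\<dots> = bregman g y x + bregman g z y - (1 / L) * inner p p"
    unfolding bregman_def zy zx
    by (simp add: p_def inner_diff_left inner_diff_right algebra_simps)
  also have "bregman g z y \<le> L / 2 * (norm (z - y))\<^sup>2"
    by (rule bregman_le_quadratic[OF diff lip])
  also have "\<dots> = (1 / (2 * L)) * inner p p"
    using L unfolding zy by (simp add: dot_square_norm power_mult_distrib field_simps power2_eq_square)
  finally have "(1 / (2 * L)) * inner p p \<le> bregman g y x"
    by (simp add: field_simps)
  then show ?thesis
    using L by (simp add: p_def power2_norm_eq_inner field_simps)
qed

section \<open>Averages of functions and of squared norms\<close>

lemma GDERIV_average: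
  fixes f :: "nat \<Rightarrow> 'a::euclidean_space \<Rightarrow> real"
  assumes "\<And>i. i \<in> {1..n} \<Longrightarrow> f i differentiable (at x)"
  shows "GDERIV (average n f) x :> (1 / real n) *\<^sub>R (\<Sum>i\<in>{1..n}. gradient (f i) x)"
proof -
  have "(f i has_derivative (\<lambda>h. inner h (gradient (f i) x))) (at x)" if "i \<in> {1..n}" for i
    using GDERIV_gradient[OF assms[OF that]] unfolding gderiv_def .
  then have "((\<lambda>x. (1 / real n) * (\<Sum>i\<in>{1..n}. f i x)) has_derivative
      (\<lambda>h. (1 / real n) * (\<Sum>i\<in>{1..n}. inner h (gradient (f i) x)))) (at x)"
    by (intro has_derivative_mult_right has_derivative_sum)
  then show ?thesis
    unfolding gderiv_def average_def[abs_def]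
    by (simp add: inner_sum_right)
qed

lemma bregman_average:
  fixes f :: "nat \<Rightarrow> 'a::euclidean_space \<Rightarrow> real"
  assumes "\<And>i. i \<in> {1..n} \<Longrightarrow> f i differentiable (at x)"
  shows "bregman (average n f) y x = (1 / real n) * (\<Sum>i\<in>{1..n}. bregman (f i) y x)"
proof -
  have "gradient (average n f) x = (1 / real n) *\<^sub>R (\<Sum>i\<in>{1..n}. gradient (f i) x)"
    by (intro gradient_eq GDERIV_average assms)
  then show ?thesis
    by (simp add: average_def bregman_def sum_subtractf inner_sum_left diff_divide_distrib)
qed

lemma sum_norm_centered:
  fixes a :: "nat \<Rightarrow> 'a::real_inner"
  assumes "(\<Sum>i\<in>{1..n}. a i) = real n *\<^sub>R m"
  shows "(\<Sum>i\<in>{1..n}. (norm (a i - m))\<^sup>2) = (\<Sum>i\<in>{1..n}. (norm (a i))\<^sup>2) - real n * (norm m)\<^sup>2"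
proof -
  have "(norm (a i - m))\<^sup>2 = (norm (a i))\<^sup>2 - 2 * inner (a i) m + (norm m)\<^sup>2" for i
    by (simp add: power2_norm_eq_inner inner_diff_left inner_diff_right inner_commute)
  then have "(\<Sum>i\<in>{1..n}. (norm (a i - m))\<^sup>2)
      = (\<Sum>i\<in>{1..n}. (norm (a i))\<^sup>2) - 2 * inner (\<Sum>i\<in>{1..n}. a i) m + real n * (norm m)\<^sup>2"
    by (simp add: sum.distrib sum_subtractf inner_sum_left sum_distrib_left)
  then show ?thesis
    unfolding assms by (simp add: dot_square_norm)
qed

text \<open>The vector is the difference of the centred \<open>a i - u\<close> and
  \<open>b i - v\<close>, plus \<open>u\<close>. Young's inequality bounds the squared difference,
  and the cross terms with \<open>u\<close> vanish in the sum because both families are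
  centred.\<close>

lemma sum_variance_bound:
  fixes a b :: "nat \<Rightarrow> 'a::real_inner"
  assumes sa: "(\<Sum>i\<in>{1..n}. a i) = real n *\<^sub>R u" and sb: "(\<Sum>i\<in>{1..n}. b i) = real n *\<^sub>R v"
  shows "(\<Sum>i\<in>{1..n}. (norm (a i - (b i - v)))\<^sup>2)
    \<le> 3 * (\<Sum>i\<in>{1..n}. (norm (a i))\<^sup>2) + 3 / 2 * (\<Sum>i\<in>{1..n}. (norm (b i))\<^sup>2)
      - 2 * real n * (norm u)\<^sup>2"
proof -
  have ptw: "(norm (a i - (b i - v)))\<^sup>2 \<le> 3 * (norm (a i - u))\<^sup>2 + 3 / 2 * (norm (b i - v))\<^sup>2
      + 2 * inner (a i - b i) u + 2 * inner (v - u) u + (norm u)\<^sup>2" for i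
  proof -
    define p q where "p = a i - u" and "q = b i - v"
    have split: "a i - (b i - v) = (p - q) + u" "a i - b i = (p - q) - (v - u)"
      by (simp_all add: p_def q_def)
    \<comment> \<open>Half of this square is exactly the gap in Young's inequality with weights
      \<open>3\<close> and \<open>3 / 2\<close>.\<close>
    have "0 \<le> inner (2 *\<^sub>R p + q) (2 *\<^sub>R p + q) / 2"
      by simp
    also have "\<dots> = 3 * inner p p + 3 / 2 * inner q q - inner (p - q) (p - q)"
      by (simp add: inner_add_left inner_add_right inner_diff_left inner_diff_right inner_commute)
    finally have "(norm ((p - q) + u))\<^sup>2
        \<le> 3 * (norm p)\<^sup>2 + 3 / 2 * (norm q)\<^sup>2 + 2 * inner (p - q) u + (norm u)\<^sup>2"
      by (simp add: power2_norm_eq_inner inner_add_left inner_add_right inner_commute)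
    then show ?thesis
      unfolding split(1) unfolding split(2) p_def[symmetric] q_def[symmetric] by (simp add: inner_diff_left)
  qed
  have "(\<Sum>i\<in>{1..n}. (norm (a i - (b i - v)))\<^sup>2) \<le> (\<Sum>i\<in>{1..n}. 3 * (norm (a i - u))\<^sup>2
      + 3 / 2 * (norm (b i - v))\<^sup>2 + 2 * inner (a i - b i) u + 2 * inner (v - u) u + (norm u)\<^sup>2)"
    by (intro sum_mono ptw)
  also have "\<dots> = 3 * (\<Sum>i\<in>{1..n}. (norm (a i - u))\<^sup>2) + 3 / 2 * (\<Sum>i\<in>{1..n}. (norm (b i - v))\<^sup>2)
      + 2 * inner ((\<Sum>i\<in>{1..n}. a i) - (\<Sum>i\<in>{1..n}. b i)) u + 2 * real n * inner (v - u) u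
      + real n * (norm u)\<^sup>2"
    by (simp add: sum.distrib sum_distrib_left inner_sum_left sum_subtractf inner_diff_left)
  \<comment> \<open>The two inner-product terms cancel. The coefficient \<open>- 2\<close> of
    \<open>real n * (norm u)\<^sup>2\<close> is \<open>- 3\<close> from centring \<open>a\<close>
    plus \<open>1\<close> from the last summand.\<close>
  also have "\<dots> = 3 * (\<Sum>i\<in>{1..n}. (norm (a i))\<^sup>2) + 3 / 2 * (\<Sum>i\<in>{1..n}. (norm (b i))\<^sup>2)
      - 2 * real n * (norm u)\<^sup>2 - 3 / 2 * (real n * (norm v)\<^sup>2)"
    unfolding sum_norm_centered[OF sa] sum_norm_centered[OF sb] sa sb
    by (simp add: inner_diff_left algebra_simps)
  also have "\<dots> \<le> 3 * (\<Sum>i\<in>{1..n}. (norm (a i))\<^sup>2) + 3 / 2 * (\<Sum>i\<in>{1..n}. (norm (b i))\<^sup>2)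
      - 2 * real n * (norm u)\<^sup>2"
    by simp
  finally show ?thesis .
qed

section \<open>Minimisers as fixed points of the projected gradient step\<close>

text \<open>At a minimiser over a convex set the negative gradient lies in the normal cone, and
  moving \<open>xs\<close> along a normal direction does not change its nearest point in
  \<open>K\<close>.\<close>

lemma closest_point_gradient_step_arg_min:
  fixes g :: "'a::euclidean_space \<Rightarrow> real"
  assumes K: "closed K" "convex K" and g: "g differentiable (at xs)"
    and min: "is_arg_min g (\<lambda>y. y \<in> K) xs" and "\<gamma> \<ge> 0"
  shows "closest_point K (xs - \<gamma> *\<^sub>R gradient g xs) = xs"
proof -
  have xs: "xs \<in> K" and le: "\<And>y. y \<in> K \<Longrightarrow> g xs \<le> g y"
    using min by (auto simp: is_arg_min_linorder)
  have opt: "inner (gradient g xs) (y - xs) \<ge> 0" if y: "y \<in> K" for y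
  proof (rule ccontr)
    assume neg: "\<not> ?thesis"
    have "((\<lambda>t. g (xs + t *\<^sub>R (y - xs))) has_real_derivative inner (gradient g xs) (y - xs)) (at 0)"
      using has_real_derivative_along_line[where t = 0 and x = xs and d = "y - xs"] g by simp
    then obtain d where d: "d > 0"
      "\<And>h. 0 < h \<Longrightarrow> h < d \<Longrightarrow> g (xs + (0 + h) *\<^sub>R (y - xs)) < g (xs + 0 *\<^sub>R (y - xs))"
      using neg DERIV_neg_dec_right by (metis not_le)
    \<comment> \<open>Half of \<open>d\<close> stays strictly inside the range of decrease; the cap
      \<open>1\<close> keeps the new point on the segment from \<open>xs\<close> to
      \<open>y\<close>, hence in \<open>K\<close>.\<close>
    define h where "h = min (d / 2) 1"
    have h: "0 < h" "h < d" "h \<le> 1"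
      using d(1) by (auto simp: h_def)
    have "xs + h *\<^sub>R (y - xs) = (1 - h) *\<^sub>R xs + h *\<^sub>R y"
      by (simp add: algebra_simps)
    also have "\<dots> \<in> K"
      using h xs y by (intro convexD[OF K(2)]) auto
    finally show False
      using le d(2)[OF h(1,2)] by force
  qed
  have "dist (xs - \<gamma> *\<^sub>R gradient g xs) xs \<le> dist (xs - \<gamma> *\<^sub>R gradient g xs) z" if z: "z \<in> K" for z
  proof -
    have "(norm (\<gamma> *\<^sub>R gradient g xs))\<^sup>2 + 2 * \<gamma> * inner (gradient g xs) (z - xs) + (norm (z - xs))\<^sup>2
        = (norm (xs - \<gamma> *\<^sub>R gradient g xs - z))\<^sup>2"
      unfolding power2_norm_eq_inner
      by (simp add: inner_diff_left inner_diff_right inner_commute algebra_simps)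
    moreover have "\<gamma> * inner (gradient g xs) (z - xs) \<ge> 0"
      using opt[OF z] \<open>\<gamma> \<ge> 0\<close> by simp
    ultimately have "(norm (\<gamma> *\<^sub>R gradient g xs))\<^sup>2 \<le> (norm (xs - \<gamma> *\<^sub>R gradient g xs - z))\<^sup>2"
      using zero_le_power2[of "norm (z - xs)"] by linarith
    then show ?thesis
      unfolding dist_norm by (subst (asm) power_mono_iff) simp_all
  qed
  then show ?thesis
    using closest_point_unique[OF K(2,1) xs] by metis
qed

section \<open>One step of SAGA\<close>

text \<open>Here \<open>A\<close> and \<open>B\<close> are the Bregman divergences of the average function between \<open>x\<close> and \<open>xs\<close>
  in the two orders, \<open>G\<close> is the squared norm of the difference of its gradients, \<open>r\<close> the squared
  distance to \<open>xs\<close>, \<open>V\<close> the mean squared deviation of the search direction from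
  the gradient at \<open>xs\<close>, and \<open>E\<close> the mean of the next \<open>r\<close>.\<close>

lemma saga_descent_arith:
  fixes H A B G V E r n L \<mu> \<gamma> c :: real
  assumes n: "n \<ge> 1" and L: "L > 0" and \<mu>: "\<mu> > 0" and \<gamma>: "\<gamma> = 1 / (6 * L)"
    and c: "c = 1 / (\<gamma> * (1 + 4 * \<mu> * \<gamma>) * n)"
    and H: "H \<ge> 0" and A: "\<mu> / 2 * r \<le> A" and B: "\<mu> / 2 * r \<le> B" and r: "r \<ge> 0"
    and AB: "A + B \<le> L * r" and G: "\<mu> * (A + B) \<le> G"
    and V: "V \<le> 3 * (2 * L * B) + 3 / 2 * (2 * L * H) - 2 * G"
    and E: "E \<le> r - 2 * \<gamma> * (A + B) + \<gamma>\<^sup>2 * V"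
  shows "(1 - 1 / n) * H + A / n + c * E \<le> (1 - min (1 / (2 * n)) (\<mu> / (6 * L))) * (H + c * r)"
proof -
  \<comment> \<open>The factor inside \<open>c\<close>: \<open>n * q * c\<close> equals
    \<open>1 / \<gamma>\<close>, so multiplying the claim by \<open>n * q\<close> clears its
    denominators.\<close>
  define q where "q = 1 + 4 * \<mu> * \<gamma>"
  define \<rho> where "\<rho> = min (1 / (2 * n)) (\<mu> / (6 * L))"
  have g0: "\<gamma> > 0" and gL: "\<gamma> * L = 1 / 6"
    using L by (auto simp: \<gamma>)
  have q1: "q \<ge> 1"
    using g0 \<mu> by (simp add: q_def)
  have \<rho>n: "\<rho> * n \<le> 1 / 2"
  proof -
    have "\<rho> * n \<le> 1 / (2 * n) * n"
      using n by (intro mult_right_mono) (auto simp: \<rho>_def)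
    then show ?thesis using n by simp
  qed
  have \<rho>\<mu>: "\<rho> \<le> \<mu> * \<gamma>"
    by (simp add: \<rho>_def \<gamma> min.coboundedI2)
  \<comment> \<open>The step size gives \<open>6 * \<gamma> * L = 1\<close>, so
    \<open>\<gamma> * V\<close> costs just one \<open>B\<close> and half an
    \<open>H\<close>.\<close>
  have "2 * (A + B) - B - H / 2 + 2 * \<gamma> * G \<le> (r - E) / \<gamma>"
  proof -
    have "\<gamma> * V \<le> \<gamma> * (3 * (2 * L * B) + 3 / 2 * (2 * L * H) - 2 * G)"
      using V g0 by (intro mult_left_mono) auto
    also have "\<dots> = 6 * (\<gamma> * L) * B + 3 * (\<gamma> * L) * H - 2 * \<gamma> * G"
      by (simp add: algebra_simps)
    finally have "\<gamma> * V \<le> B + H / 2 - 2 * \<gamma> * G"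
      by (simp add: gL)
    moreover have "2 * (A + B) - \<gamma> * V \<le> (r - E) / \<gamma>"
      using E g0 by (simp add: field_simps power2_eq_square)
    ultimately show ?thesis by linarith
  qed
  moreover have "2 * \<gamma> * \<mu> * (A + B) \<le> 2 * \<gamma> * G"
    using G g0 by simp
  \<comment> \<open>The decrease of the table part pays for the \<open>H / 2\<close> above; this
    uses the first branch of the minimum, the next estimate the second.\<close>
  moreover have "H / 2 \<le> q * H * (1 - \<rho> * n)"
  proof -
    have "1 * (1 / 2) \<le> q * (1 - \<rho> * n)"
      using q1 \<rho>n by (intro mult_mono) auto
    then have "1 * (1 / 2) * H \<le> q * (1 - \<rho> * n) * H"
      using H by (intro mult_right_mono) auto
    then show ?thesis by (simp add: mult_ac)
  qed
  moreover have "\<rho> * r / \<gamma> \<le> \<mu> * r"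
  proof -
    have "\<rho> * r \<le> \<mu> * \<gamma> * r"
      by (rule mult_right_mono[OF \<rho>\<mu> r])
    then show ?thesis using g0 by (simp add: field_simps)
  qed
  \<comment> \<open>The right side collects all terms in \<open>A\<close> and \<open>B\<close>,
    including \<open>- q * A\<close> from the table update and the gain from \<open>G\<close>. The
    \<open>4\<close> in \<open>q\<close> turns the gain for \<open>A\<close> into a loss.\<close>
  moreover have "\<mu> * r \<le> A * (1 - 2 * \<gamma> * \<mu>) + B * (1 + 2 * \<gamma> * \<mu>)"
  \<comment> \<open>Only for nonzero \<open>r\<close> do the bounds on \<open>A + B\<close> yield
    \<open>\<mu> \<le> L\<close>, which makes the coefficient of \<open>A\<close>
    nonnegative.\<close>
  proof (cases "r = 0")
    case True
    then have "A = 0" "B = 0"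
      using A B AB by auto
    then show ?thesis using True by simp
  next
    case False
    have "\<mu> * r \<le> L * r"
      using A B AB by (simp add: field_simps)
    then have "\<gamma> * \<mu> \<le> \<gamma> * L"
      using False r g0 by simp
    then have "1 - 2 * \<gamma> * \<mu> \<ge> 0"
      unfolding gL by simp
    then have "\<mu> / 2 * r * (1 - 2 * \<gamma> * \<mu>) \<le> A * (1 - 2 * \<gamma> * \<mu>)"
      using A by (intro mult_right_mono)
    moreover have "\<mu> / 2 * r * (1 + 2 * \<gamma> * \<mu>) \<le> B * (1 + 2 * \<gamma> * \<mu>)"
      using B g0 \<mu> by (intro mult_right_mono) auto
    ultimately show ?thesis by (simp add: algebra_simps)
  qed
  moreover have "q * A = A + 4 * \<mu> * \<gamma> * A"
    by (simp add: q_def algebra_simps)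
  ultimately have "0 \<le> q * H * (1 - \<rho> * n) - \<rho> * r / \<gamma> - q * A + (r - E) / \<gamma>"
    by (simp add: algebra_simps)
  also have "\<dots> = n * q * ((1 - \<rho>) * (H + c * r) - ((1 - 1 / n) * H + A / n + c * E))"
  proof -
    have nqc: "n * q * c = 1 / \<gamma>"
      using n q1 g0 unfolding c q_def[symmetric] by (simp add: field_simps)
    have "n * q * ((1 - \<rho>) * (H + c * r) - ((1 - 1 / n) * H + A / n + c * E))
        = q * H * (n * (1 / n) - \<rho> * n) - \<rho> * r * (n * q * c) - q * A * (n * (1 / n))
          + (r - E) * (n * q * c)"
      by (simp add: algebra_simps)
    also have "\<dots> = q * H * (1 - \<rho> * n) - \<rho> * r / \<gamma> - q * A + (r - E) / \<gamma>"
      using n unfolding nqc by simp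
    finally show ?thesis by simp
  qed
  finally have "0 \<le> (1 - \<rho>) * (H + c * r) - ((1 - 1 / n) * H + A / n + c * E)"
    using n q1 by (smt (verit) mult_pos_pos zero_le_mult_iff)
  then show ?thesis by (simp add: \<rho>_def)
qed

section \<open>The Lyapunov function after one update\<close>

lemma saga_lyapunov_eq_bregman:
  "saga_lyapunov n f xs c x \<phi>
    = (1 / real n) * (\<Sum>i\<in>{1..n}. bregman (f i) (\<phi> i) xs) + c * (norm (x - xs))\<^sup>2"
  by (simp add: saga_lyapunov_def average_def bregman_def sum_subtractf diff_divide_distrib)

text \<open>A trajectory fixes the table on \<open>{1..n}\<close> only, so the next table agrees
  with the function update only there.\<close>

lemma saga_lyapunov_cong:
  "(\<And>i. i \<in> {1..n} \<Longrightarrow> \<phi> i = \<psi> i) \<Longrightarrow> saga_lyapunov n f xs c x \<phi> = saga_lyapunov n f xs c x \<psi>"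
  by (simp add: saga_lyapunov_eq_bregman)

text \<open>Entry \<open>i\<close> is overwritten for exactly one index \<open>j\<close> and
  survives for the other \<open>n - 1\<close>.\<close>

lemma sum_fun_upd_table:
  fixes F :: "nat \<Rightarrow> 'a \<Rightarrow> real"
  assumes "n \<ge> 1"
  shows "(\<Sum>j\<in>{1..n}. \<Sum>i\<in>{1..n}. F i ((\<phi>(j := y)) i))
    = (real n - 1) * (\<Sum>i\<in>{1..n}. F i (\<phi> i)) + (\<Sum>i\<in>{1..n}. F i y)"
proof -
  have "(\<Sum>i\<in>{1..n}. F i ((\<phi>(j := y)) i)) = (\<Sum>i\<in>{1..n}. F i (\<phi> i)) - F j (\<phi> j) + F j y"
    if "j \<in> {1..n}" for j
  proof -
    have "(\<Sum>i\<in>{1..n} - {j}. F i ((\<phi>(j := y)) i)) = (\<Sum>i\<in>{1..n} - {j}. F i (\<phi> i))"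
      by (intro sum.cong) auto
    then show ?thesis
      using that by (simp add: sum.remove[of _ j])
  qed
  then have "(\<Sum>j\<in>{1..n}. \<Sum>i\<in>{1..n}. F i ((\<phi>(j := y)) i))
      = (\<Sum>j\<in>{1..n}. (\<Sum>i\<in>{1..n}. F i (\<phi> i)) - F j (\<phi> j) + F j y)"
    by (intro sum.cong) auto
  then show ?thesis
    by (simp add: sum.distrib sum_subtractf algebra_simps)
qed

text \<open>The updated entry \<open>j\<close> is replaced by its value \<open>x\<close>, so the
  direction depends only on the old state and the index.\<close>

definition saga_direction ::
    "nat \<Rightarrow> (nat \<Rightarrow> 'a::real_inner \<Rightarrow> real) \<Rightarrow> nat \<Rightarrow> 'a \<Rightarrow> (nat \<Rightarrow> 'a) \<Rightarrow> 'a" where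
  "saga_direction n f j x \<phi> = gradient (f j) x - gradient (f j) (\<phi> j)
     + (1 / real n) *\<^sub>R (\<Sum>i\<in>{1..n}. gradient (f i) (\<phi> i))"

definition saga_step_lyapunov ::
    "'a::{real_inner,heine_borel} set \<Rightarrow> nat \<Rightarrow> (nat \<Rightarrow> 'a \<Rightarrow> real) \<Rightarrow> 'a \<Rightarrow> real \<Rightarrow> real \<Rightarrow>
     nat \<Rightarrow> 'a \<Rightarrow> (nat \<Rightarrow> 'a) \<Rightarrow> real" where
  "saga_step_lyapunov K n f xs \<gamma> c j x \<phi> = saga_lyapunov n f xs c
     (closest_point K (x - \<gamma> *\<^sub>R saga_direction n f j x \<phi>)) (\<phi>(j := x))"

text \<open>The probability-free core: for a fixed state, the mean over the drawn index is a finite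
  sum.\<close>

lemma saga_descent:
  fixes K :: "'a::euclidean_space set" and x xs :: 'a
  assumes K: "closed K" "convex K" and n: "n \<ge> 1" and L: "L > 0"
    and conv: "\<And>i. i \<in> {1..n} \<Longrightarrow> convex_on UNIV (f i)"
    and diff: "\<And>i y. i \<in> {1..n} \<Longrightarrow> f i differentiable (at y)"
    and lip: "\<And>i. i \<in> {1..n} \<Longrightarrow> L-lipschitz_on UNIV (gradient (f i))"
    and min: "is_arg_min (average n f) (\<lambda>y. y \<in> K) xs"
    and cone: "cone_strong_convexity_const K (average n f) xs \<mu>"
    and \<gamma>: "\<gamma> = 1 / (6 * L)" and c: "c = 1 / (\<gamma> * (1 + 4 * \<mu> * \<gamma>) * real n)"
    and x: "x \<in> K"
  shows "(\<Sum>j\<in>{1..n}. 1 / real n * saga_step_lyapunov K n f xs \<gamma> c j x \<phi>)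
    \<le> (1 - min (1 / (2 * real n)) (\<mu> / (6 * L))) * saga_lyapunov n f xs c x \<phi>"
proof -
  define g where "g = gradient (average n f)"
  define a b where "a = (\<lambda>j. gradient (f j) x - gradient (f j) xs)"
    and "b = (\<lambda>j. gradient (f j) (\<phi> j) - gradient (f j) xs)"
  define u v where "u = g x - g xs" and "v = (1 / real n) *\<^sub>R (\<Sum>i\<in>{1..n}. b i)"
  define H where "H = (1 / real n) * (\<Sum>i\<in>{1..n}. bregman (f i) (\<phi> i) xs)"
  define A B where "A = bregman (average n f) x xs" and "B = bregman (average n f) xs x"
  define r where "r = (norm (x - xs))\<^sup>2"
  define V where "V = (1 / real n) * (\<Sum>j\<in>{1..n}. (norm (a j - (b j - v)))\<^sup>2)"
  define E where "E = (1 / real n) *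
    (\<Sum>j\<in>{1..n}. (norm (closest_point K (x - \<gamma> *\<^sub>R saga_direction n f j x \<phi>) - xs))\<^sup>2)"
  have avg: "bregman (average n f) y z = (1 / real n) * (\<Sum>i\<in>{1..n}. bregman (f i) y z)" for y z
    by (intro bregman_average diff)
  have \<mu>: "\<mu> > 0" and A: "\<mu> / 2 * r \<le> A" and B: "\<mu> / 2 * r \<le> B"
    using cone x by (auto simp: cone_strong_convexity_const_def A_def B_def bregman_def r_def)
  have g0: "\<gamma> \<ge> 0" using L by (simp add: \<gamma>)
  have g_avg: "g y = (1 / real n) *\<^sub>R (\<Sum>i\<in>{1..n}. gradient (f i) y)" for y
    unfolding g_def by (intro gradient_eq GDERIV_average diff)
  have sa: "(\<Sum>i\<in>{1..n}. a i) = real n *\<^sub>R u" and sb: "(\<Sum>i\<in>{1..n}. b i) = real n *\<^sub>R v"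
    using n by (simp_all add: a_def u_def v_def sum_subtractf g_avg scaleR_diff_right)
  have AB: "A + B = inner u (x - xs)"
    by (simp add: A_def B_def bregman_def u_def g_def inner_diff_left inner_diff_right)
  have na: "norm (a i) \<le> L * norm (x - xs)" if "i \<in> {1..n}" for i
    using lipschitz_onD[OF lip[OF that], of x xs] by (simp add: a_def dist_norm)
  have "inner u (x - xs) \<le> L * r"
  proof -
    have "real n * inner u (x - xs) = (\<Sum>i\<in>{1..n}. inner (a i) (x - xs))"
      by (metis inner_scaleR_left inner_sum_left sa)
    also have "\<dots> \<le> (\<Sum>i\<in>{1..n}. L * r)"
    proof (rule sum_mono)
      fix i assume "i \<in> {1..n}"
      then have "norm (a i) * norm (x - xs) \<le> L * norm (x - xs) * norm (x - xs)"
        by (intro mult_right_mono na) auto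
      then show "inner (a i) (x - xs) \<le> L * r"
        using norm_cauchy_schwarz[of "a i" "x - xs"] by (simp add: r_def power2_eq_square mult_ac)
    qed
    finally show ?thesis using n by simp
  qed
  have G: "\<mu> * (A + B) \<le> (norm u)\<^sup>2"
  proof (cases "r = 0")
    case True
    then show ?thesis by (simp add: AB r_def)
  next
    case False
    then have r0: "r > 0" by (simp add: r_def)
    have AB0: "A + B \<ge> \<mu> * r"
      using A B by simp
    then have nn: "A + B \<ge> 0"
      using \<mu> r0 by (smt (verit) mult_pos_pos)
    \<comment> \<open>As \<open>A + B\<close> is the inner product of \<open>u\<close> with
      \<open>x - xs\<close>, Cauchy-Schwarz bounds its square by
      \<open>(norm u)\<^sup>2 * r\<close>; one factor \<open>A + B\<close> is traded for
      \<open>\<mu> * r\<close>, and \<open>r\<close> cancels.\<close>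
    have "\<mu> * r * (A + B) \<le> (A + B) * (A + B)"
      by (rule mult_right_mono[OF AB0 nn])
    also have "\<dots> \<le> (norm u * norm (x - xs)) * (norm u * norm (x - xs))"
      using norm_cauchy_schwarz[of u "x - xs"] nn unfolding AB by (intro mult_mono) auto
    also have "\<dots> = (norm u)\<^sup>2 * r"
      by (simp add: r_def power2_eq_square)
    finally show ?thesis using r0 by (simp add: mult_ac)
  qed
  have H0: "H \<ge> 0"
    unfolding H_def by (intro mult_nonneg_nonneg sum_nonneg bregman_nonneg conv diff) auto
  have V: "V \<le> 3 * (2 * L * B) + 3 / 2 * (2 * L * H) - 2 * (norm u)\<^sup>2"
  proof -
    have "(norm (a i))\<^sup>2 \<le> 2 * L * bregman (f i) xs x" if "i \<in> {1..n}" for i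
      using norm_gradient_diff_le_bregman[OF conv[OF that] diff[OF that] lip[OF that] L, of xs x]
      by (simp add: a_def norm_minus_commute)
    then have 1: "(\<Sum>i\<in>{1..n}. (norm (a i))\<^sup>2) \<le> (\<Sum>i\<in>{1..n}. 2 * L * bregman (f i) xs x)"
      by (intro sum_mono)
    have "(norm (b i))\<^sup>2 \<le> 2 * L * bregman (f i) (\<phi> i) xs" if "i \<in> {1..n}" for i
      using norm_gradient_diff_le_bregman[OF conv[OF that] diff[OF that] lip[OF that] L, of "\<phi> i" xs]
      by (simp add: b_def)
    then have 2: "(\<Sum>i\<in>{1..n}. (norm (b i))\<^sup>2) \<le> (\<Sum>i\<in>{1..n}. 2 * L * bregman (f i) (\<phi> i) xs)"
      by (intro sum_mono)
    have B_eq: "(\<Sum>i\<in>{1..n}. 2 * L * bregman (f i) xs x) = real n * (2 * L * B)"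
      using n by (simp add: avg B_def sum_distrib_left)
    have H_eq: "(\<Sum>i\<in>{1..n}. 2 * L * bregman (f i) (\<phi> i) xs) = real n * (2 * L * H)"
      using n by (simp add: H_def sum_distrib_left)
    have "real n * V = (\<Sum>j\<in>{1..n}. (norm (a j - (b j - v)))\<^sup>2)"
      using n by (simp add: V_def)
    also have "\<dots> \<le> real n * (3 * (2 * L * B) + 3 / 2 * (2 * L * H) - 2 * (norm u)\<^sup>2)"
      using sum_variance_bound[OF sa sb] 1 2 unfolding B_eq H_eq by (simp add: algebra_simps)
    finally show ?thesis using n by simp
  qed
  have E: "E \<le> r - 2 * \<gamma> * (A + B) + \<gamma>\<^sup>2 * V"
  proof -
    have dir: "saga_direction n f j x \<phi> - g xs = a j - (b j - v)" for j
    proof -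
      have "v = (1 / real n) *\<^sub>R (\<Sum>i\<in>{1..n}. gradient (f i) (\<phi> i)) - g xs"
        using n by (simp add: v_def b_def sum_subtractf scaleR_diff_right g_avg)
      then show ?thesis
        by (simp add: saga_direction_def a_def b_def)
    qed
    have "GDERIV (average n f) xs :> g xs"
      unfolding g_avg by (intro GDERIV_average diff)
    then have "average n f differentiable (at xs)"
      unfolding gderiv_def differentiable_def by blast
    \<comment> \<open>Writing \<open>xs\<close> as a projection lets nonexpansiveness compare the
      two unprojected points.\<close>
    then have fixp: "closest_point K (xs - \<gamma> *\<^sub>R g xs) = xs"
      unfolding g_def by (intro closest_point_gradient_step_arg_min K min g0)
    have norm_sq: "(norm (p - \<gamma> *\<^sub>R q))\<^sup>2 = (norm p)\<^sup>2 - 2 * \<gamma> * inner q p + \<gamma>\<^sup>2 * (norm q)\<^sup>2"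
      for p q :: 'a
      unfolding power2_norm_eq_inner
      by (simp add: inner_diff_left inner_diff_right inner_commute power2_eq_square)
    have step: "(norm (closest_point K (x - \<gamma> *\<^sub>R saga_direction n f j x \<phi>) - xs))\<^sup>2
        \<le> r - 2 * \<gamma> * inner (a j - (b j - v)) (x - xs) + \<gamma>\<^sup>2 * (norm (a j - (b j - v)))\<^sup>2" for j
    proof -
      have "norm (closest_point K (x - \<gamma> *\<^sub>R saga_direction n f j x \<phi>) - xs)
          \<le> norm ((x - \<gamma> *\<^sub>R saga_direction n f j x \<phi>) - (xs - \<gamma> *\<^sub>R g xs))"
        using closest_point_lipschitz[OF K(2,1), of "x - \<gamma> *\<^sub>R saga_direction n f j x \<phi>"
            "xs - \<gamma> *\<^sub>R g xs"] x
        unfolding fixp dist_norm by auto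
      also have "(x - \<gamma> *\<^sub>R saga_direction n f j x \<phi>) - (xs - \<gamma> *\<^sub>R g xs)
          = (x - xs) - \<gamma> *\<^sub>R (a j - (b j - v))"
        by (simp add: scaleR_diff_right flip: dir)
      finally have "(norm (closest_point K (x - \<gamma> *\<^sub>R saga_direction n f j x \<phi>) - xs))\<^sup>2
          \<le> (norm ((x - xs) - \<gamma> *\<^sub>R (a j - (b j - v))))\<^sup>2"
        by (simp add: power_mono)
      also have "\<dots> = r - 2 * \<gamma> * inner (a j - (b j - v)) (x - xs)
          + \<gamma>\<^sup>2 * (norm (a j - (b j - v)))\<^sup>2"
        unfolding r_def by (rule norm_sq)
      finally show ?thesis .
    qed
    have "real n * E = (\<Sum>j\<in>{1..n}.
        (norm (closest_point K (x - \<gamma> *\<^sub>R saga_direction n f j x \<phi>) - xs))\<^sup>2)"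
      using n by (simp add: E_def)
    also have "\<dots> \<le> (\<Sum>j\<in>{1..n}. r - 2 * \<gamma> * inner (a j - (b j - v)) (x - xs)
        + \<gamma>\<^sup>2 * (norm (a j - (b j - v)))\<^sup>2)"
      by (intro sum_mono step)
    also have "\<dots> = real n * r - 2 * \<gamma> * inner (\<Sum>j\<in>{1..n}. a j - (b j - v)) (x - xs)
        + \<gamma>\<^sup>2 * (\<Sum>j\<in>{1..n}. (norm (a j - (b j - v)))\<^sup>2)"
      by (simp only: sum.distrib sum_subtractf[of "\<lambda>_. r"] sum_distrib_left inner_sum_left
          sum_constant card_atLeastAtMost diff_Suc_1 Suc_eq_plus1[symmetric])
    \<comment> \<open>Unbiasedness of the direction: the centred table corrections sum to
      zero.\<close>
    also have "(\<Sum>j\<in>{1..n}. a j - (b j - v)) = real n *\<^sub>R u"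
      by (simp add: sum_subtractf sa[simplified] sb[simplified] sum_constant_scaleR)
    also have "(\<Sum>j\<in>{1..n}. (norm (a j - (b j - v)))\<^sup>2) = real n * V"
      using n by (simp add: V_def)
    finally have "real n * E \<le> real n * (r - 2 * \<gamma> * (A + B) + \<gamma>\<^sup>2 * V)"
      by (simp add: AB algebra_simps)
    then show ?thesis using n by simp
  qed
  have "(\<Sum>j\<in>{1..n}. 1 / real n * saga_step_lyapunov K n f xs \<gamma> c j x \<phi>)
      = (1 / real n) * ((1 / real n) * (\<Sum>j\<in>{1..n}. \<Sum>i\<in>{1..n}. bregman (f i) ((\<phi>(j := x)) i) xs)) + c * E"
    unfolding saga_step_lyapunov_def saga_lyapunov_eq_bregman E_def
    by (simp add: sum.distrib sum_distrib_left distrib_left mult_ac)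
  also have "\<dots> = (1 - 1 / real n) * H + A / real n + c * E"
    unfolding sum_fun_upd_table[OF n, of "\<lambda>i z. bregman (f i) z xs"] A_def H_def avg
    using n by (simp add: field_simps)
  also have "\<dots> \<le> (1 - min (1 / (2 * real n)) (\<mu> / (6 * L))) * (H + c * r)"
    by (rule saga_descent_arith[OF _ L \<mu> \<gamma> c H0 A B _ _ G V E])
      (use n \<open>inner u (x - xs) \<le> L * r\<close> in \<open>auto simp: AB r_def\<close>)
  finally show ?thesis
    by (simp add: saga_lyapunov_eq_bregman H_def r_def)
qed

section \<open>Conditional expectation over the random index\<close>

text \<open>Preimages of singletons under \<open>h\<close> are unions of fibres of \<open>X\<close>,
  so \<open>h\<close> factors through \<open>X\<close>. This later makes the Lyapunov values bounded
  and thus integrable.\<close>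

lemma finite_image_vimage_algebra:
  fixes h :: "'w \<Rightarrow> real"
  assumes h: "h \<in> borel_measurable (vimage_algebra \<Omega> X N)" and X: "X \<in> \<Omega> \<rightarrow> space N"
    and fin: "finite (X ` \<Omega>)"
  shows "finite (h ` \<Omega>)"
proof -
  have "h \<omega> = h \<omega>'" if \<omega>: "\<omega> \<in> \<Omega>" "\<omega>' \<in> \<Omega>" "X \<omega> = X \<omega>'" for \<omega> \<omega>'
  proof -
    have "h -` {h \<omega>'} \<inter> \<Omega> \<in> sets (vimage_algebra \<Omega> X N)"
      using measurable_sets[OF h, of "{h \<omega>'}"] by simp
    then obtain A where "h -` {h \<omega>'} \<inter> \<Omega> = X -` A \<inter> \<Omega>"
      by (auto simp: sets_vimage_algebra2[OF X])
    then show ?thesis using \<omega> by auto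
  qed
  then have "h ` \<Omega> \<subseteq> (\<lambda>y. h (SOME \<omega>. \<omega> \<in> \<Omega> \<and> X \<omega> = y)) ` X ` \<Omega>"
    by (smt (verit, best) image_iff someI_ex subsetI)
  then show ?thesis
    using fin finite_subset by blast
qed

text \<open>Split along the value of \<open>J\<close>: each \<open>g i\<close> is
  \<open>F\<close>-measurable and factors out, while by independence the indicator of
  \<open>J = i\<close> has the constant conditional expectation \<open>p i\<close>.\<close>

lemma (in prob_space) real_cond_exp_random_index:
  fixes g :: "'i \<Rightarrow> 'a \<Rightarrow> real"
  assumes F: "subalgebra M F" and I: "finite I"
    and J [measurable]: "J \<in> measurable M (count_space I)"
    and indep: "\<And>A i. A \<in> sets F \<Longrightarrow> i \<in> I \<Longrightarrow> prob (A \<inter> (J -` {i} \<inter> space M)) = prob A * p i"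
    and gF: "\<And>i. i \<in> I \<Longrightarrow> g i \<in> borel_measurable F"
    and gint: "\<And>i. i \<in> I \<Longrightarrow> integrable M (g i)"
  shows "AE \<omega> in M. real_cond_exp M F (\<lambda>\<omega>. g (J \<omega>) \<omega>) \<omega> = (\<Sum>i\<in>I. p i * g i \<omega>)"
proof -
  interpret finite_measure_subalgebra M F
    by standard (rule F)
  define ind :: "'i \<Rightarrow> 'a \<Rightarrow> real" where "ind = (\<lambda>i. indicator (J -` {i} \<inter> space M))"
  \<comment> \<open>The value \<open>0\<close> outside \<open>I\<close> makes \<open>h i\<close>
    integrable for every \<open>i\<close>, as \<open>real_cond_exp_sum\<close> is applied to
    \<open>h_int\<close> without a restriction on the index.\<close>
  define h where "h = (\<lambda>i \<omega>. (if i \<in> I then g i \<omega> else 0) * ind i \<omega>)"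
  have ev: "J -` {i} \<inter> space M \<in> events" if "i \<in> I" for i
    using that by (intro measurable_sets[OF J]) auto
  have h_int: "integrable M (h i)" for i
  proof (cases "i \<in> I")
    case True
    then show ?thesis
      using integrable_mult_indicator[OF ev gint, OF True True] by (simp add: h_def ind_def mult.commute)
  qed (simp add: h_def)
  have h_cond: "AE \<omega> in M. real_cond_exp M F (h i) \<omega> = p i * g i \<omega>" if i: "i \<in> I" for i
  proof -
    have "AE \<omega> in M. real_cond_exp M F (ind i) \<omega> = p i"
    proof (rule real_cond_exp_charact)
      fix A assume A: "A \<in> sets F"
      then have AM: "A \<in> events"
        using F by (auto simp: subalgebra_def)
      have "(\<integral>\<omega>\<in>A. ind i \<omega> \<partial>M) = (\<integral>\<omega>. indicator (A \<inter> (J -` {i} \<inter> space M)) \<omega> \<partial>M)"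
        by (simp add: set_lebesgue_integral_def ind_def indicator_inter_arith)
      also have "\<dots> = prob A * p i"
        using indep[OF A i] AM ev[OF i] by simp
      also have "\<dots> = (\<integral>\<omega>\<in>A. p i \<partial>M)"
        using AM by (simp add: set_lebesgue_integral_def)
      finally show "(\<integral>\<omega>\<in>A. ind i \<omega> \<partial>M) = (\<integral>\<omega>\<in>A. p i \<partial>M)" .
    next
      show "integrable M (ind i)"
        unfolding ind_def using ev[OF i] by (simp add: less_top[symmetric])
    qed simp_all
    moreover have "AE \<omega> in M. real_cond_exp M F (\<lambda>\<omega>. g i \<omega> * ind i \<omega>) \<omega>
        = g i \<omega> * real_cond_exp M F (ind i) \<omega>"
      using h_int[of i] borel_measurable_indicator[OF ev[OF i]] i
      by (intro real_cond_exp_mult gF) (auto simp: h_def ind_def)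
    ultimately show ?thesis
      using i by (auto simp: h_def mult.commute)
  qed
  have g_eq: "g (J \<omega>) \<omega> = (\<Sum>i\<in>I. h i \<omega>)" if "\<omega> \<in> space M" for \<omega>
  proof -
    have "J \<omega> \<in> I"
      using measurable_space[OF J that] by simp
    moreover have "(\<Sum>i\<in>I. h i \<omega>) = (\<Sum>i\<in>I. if i = J \<omega> then g i \<omega> else 0)"
      using that by (intro sum.cong) (auto simp: h_def ind_def)
    ultimately show ?thesis
      using I by simp
  qed
  have sum_meas: "(\<lambda>\<omega>. \<Sum>i\<in>I. h i \<omega>) \<in> borel_measurable M"
    using h_int by (intro borel_measurable_sum) auto
  have "AE \<omega> in M. real_cond_exp M F (\<lambda>\<omega>. g (J \<omega>) \<omega>) \<omega> = real_cond_exp M F (\<lambda>\<omega>. \<Sum>i\<in>I. h i \<omega>) \<omega>"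
    using sum_meas measurable_cong[of M "\<lambda>\<omega>. g (J \<omega>) \<omega>" "\<lambda>\<omega>. \<Sum>i\<in>I. h i \<omega>", OF g_eq]
    by (intro real_cond_exp_cong AE_I2 g_eq) auto
  moreover have "AE \<omega> in M. real_cond_exp M F (\<lambda>\<omega>. \<Sum>i\<in>I. h i \<omega>) \<omega> = (\<Sum>i\<in>I. real_cond_exp M F (h i) \<omega>)"
    by (rule real_cond_exp_sum[OF h_int])
  moreover have "AE \<omega> in M. \<forall>i\<in>I. real_cond_exp M F (h i) \<omega> = p i * g i \<omega>"
    using I h_cond by (intro AE_finite_allI) auto
  ultimately show ?thesis
    by eventually_elim simp
qed

section \<open>Trajectories and their measurability\<close>

lemma saga_trajectory_Suc:
  assumes "saga_trajectory K n f \<gamma> x0 j x \<phi>"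
  shows "x (Suc k) = closest_point K (x k - \<gamma> *\<^sub>R saga_direction n f (j k) (x k) (\<phi> k))"
    and "i \<in> {1..n} \<Longrightarrow> \<phi> (Suc k) i = ((\<phi> k)(j k := x k)) i"
  using assms unfolding saga_trajectory_def saga_direction_def by (auto simp del: atLeastAtMost_iff)

lemma saga_trajectory_in_set:
  fixes K :: "'a::euclidean_space set"
  assumes "saga_trajectory K n f \<gamma> x0 j x \<phi>" and "closed K" and "x0 \<in> K"
  shows "x k \<in> K"
proof (cases k)
  case 0
  then show ?thesis using assms by (simp add: saga_trajectory_def)
next
  case (Suc l)
  then show ?thesis
    using closest_point_in_set[of K] assms(2,3) saga_trajectory_Suc(1)[OF assms(1)] by (metis empty_iff)
qed

lemma borel_measurable_gradient:
  assumes "L-lipschitz_on UNIV (gradient g)"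
  shows "gradient g \<in> borel_measurable borel"
  using assms by (intro borel_measurable_continuous_onI lipschitz_on_continuous_on)

lemma measurable_saga_direction:
  fixes f :: "nat \<Rightarrow> 'a::euclidean_space \<Rightarrow> real"
  assumes lip: "\<And>i. i \<in> {1..n} \<Longrightarrow> L-lipschitz_on UNIV (gradient (f i))"
    and x: "x \<in> borel_measurable N" and \<phi>: "\<And>i. i \<in> {1..n} \<Longrightarrow> \<phi> i \<in> borel_measurable N"
    and j: "j \<in> {1..n}"
  shows "(\<lambda>\<omega>. saga_direction n f j (x \<omega>) (\<lambda>i. \<phi> i \<omega>)) \<in> borel_measurable N"
proof -
  have "(\<lambda>\<omega>. gradient (f i) (\<phi> i \<omega>)) \<in> borel_measurable N" if "i \<in> {1..n}" for i
    using measurable_compose[OF \<phi>[OF that] borel_measurable_gradient[OF lip[OF that]]] .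
  moreover have "(\<lambda>\<omega>. gradient (f j) (x \<omega>)) \<in> borel_measurable N"
    using measurable_compose[OF x borel_measurable_gradient[OF lip[OF j]]] .
  ultimately show ?thesis
    unfolding saga_direction_def using j
    by (intro borel_measurable_add borel_measurable_diff borel_measurable_scaleR
        borel_measurable_sum borel_measurable_const)
qed

lemma borel_measurable_closest_point:
  fixes K :: "'a::euclidean_space set"
  assumes "closed K" "convex K" "K \<noteq> {}"
  shows "closest_point K \<in> borel_measurable borel"
  using assms by (intro borel_measurable_continuous_onI continuous_on_closest_point)

lemma measurable_saga_step_lyapunov:
  fixes f :: "nat \<Rightarrow> 'a::euclidean_space \<Rightarrow> real"
  assumes K: "closed K" "convex K" "K \<noteq> {}"
    and diff: "\<And>i y. i \<in> {1..n} \<Longrightarrow> f i differentiable (at y)"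
    and lip: "\<And>i. i \<in> {1..n} \<Longrightarrow> L-lipschitz_on UNIV (gradient (f i))"
    and x: "x \<in> borel_measurable N" and \<phi>: "\<And>i. i \<in> {1..n} \<Longrightarrow> \<phi> i \<in> borel_measurable N"
    and j: "j \<in> {1..n}"
  shows "(\<lambda>\<omega>. saga_step_lyapunov K n f xs \<gamma> c j (x \<omega>) (\<lambda>i. \<phi> i \<omega>)) \<in> borel_measurable N"
proof -
  have "(\<lambda>\<omega>. x \<omega> - \<gamma> *\<^sub>R saga_direction n f j (x \<omega>) (\<lambda>i. \<phi> i \<omega>)) \<in> borel_measurable N"
    by (intro borel_measurable_diff borel_measurable_scaleR borel_measurable_const x
        measurable_saga_direction[OF lip x \<phi> j])
  from measurable_compose[OF this borel_measurable_closest_point[OF K]]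
  have [measurable]: "(\<lambda>\<omega>. closest_point K (x \<omega> - \<gamma> *\<^sub>R saga_direction n f j (x \<omega>) (\<lambda>i. \<phi> i \<omega>)))
      \<in> borel_measurable N" .
  have "(\<lambda>\<omega>. bregman (f i) (((\<lambda>i. \<phi> i \<omega>)(j := x \<omega>)) i) xs) \<in> borel_measurable N"
    if i: "i \<in> {1..n}" for i
  proof -
    have "continuous_on UNIV (f i)"
      using diff[OF i] by (simp add: differentiable_imp_continuous_on differentiable_on_def)
    then have [measurable]: "f i \<in> borel_measurable borel"
      by (rule borel_measurable_continuous_onI)
    have [measurable]: "(\<lambda>\<omega>. ((\<lambda>i. \<phi> i \<omega>)(j := x \<omega>)) i) \<in> borel_measurable N"
      using x \<phi>[OF i] by (cases "i = j") auto
    show ?thesis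
      unfolding bregman_def by measurable
  qed
  then have [measurable]: "(\<lambda>\<omega>. \<Sum>i\<in>{1..n}. bregman (f i) (((\<lambda>i. \<phi> i \<omega>)(j := x \<omega>)) i) xs)
      \<in> borel_measurable N"
    by (intro borel_measurable_sum)
  show ?thesis
    unfolding saga_step_lyapunov_def saga_lyapunov_eq_bregman by measurable
qed

text \<open>Taking \<open>N\<close> to be the \<open>\<sigma>\<close>-algebra generated by the first \<open>k\<close> indices expresses that the
  state at time \<open>k\<close> depends on the past only.\<close>

lemma measurable_saga_state:
  fixes K :: "'a::euclidean_space set"
  assumes K: "closed K" "convex K" "K \<noteq> {}"
    and lip: "\<And>i. i \<in> {1..n} \<Longrightarrow> L-lipschitz_on UNIV (gradient (f i))"
    and J: "\<And>l. l < k \<Longrightarrow> J l \<in> measurable N (count_space {1..n})"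
    and traj: "\<And>\<omega>. \<omega> \<in> space N \<Longrightarrow>
      saga_trajectory K n f \<gamma> x0 (\<lambda>l. J l \<omega>) (\<lambda>l. x l \<omega>) (\<lambda>l i. \<phi> l i \<omega>)"
    and "l \<le> k"
  shows "x l \<in> borel_measurable N \<and> (\<forall>i\<in>{1..n}. \<phi> l i \<in> borel_measurable N)"
  using \<open>l \<le> k\<close>
proof (induction l)
  case 0
  have "x 0 \<omega> = x0" "\<forall>i\<in>{1..n}. \<phi> 0 i \<omega> = x0" if "\<omega> \<in> space N" for \<omega>
    using traj[OF that] by (auto simp: saga_trajectory_def)
  then show ?case
    by (auto cong: measurable_cong)
next
  case (Suc l)
  then have x: "x l \<in> borel_measurable N" and \<phi>: "\<And>i. i \<in> {1..n} \<Longrightarrow> \<phi> l i \<in> borel_measurable N"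
    and Jl: "J l \<in> measurable N (count_space {1..n})"
    using J by auto
  have "(\<lambda>\<omega>. closest_point K (x l \<omega> - \<gamma> *\<^sub>R saga_direction n f (J l \<omega>) (x l \<omega>) (\<lambda>i. \<phi> l i \<omega>)))
      \<in> borel_measurable N"
  \<comment> \<open>The index is random but has countably many values, so measurability for each
    fixed \<open>j\<close> suffices.\<close>
  proof (rule measurable_compose_countable'[where I = "{1..n}" and g = "J l" and
        f = "\<lambda>j \<omega>. closest_point K (x l \<omega> - \<gamma> *\<^sub>R saga_direction n f j (x l \<omega>) (\<lambda>i. \<phi> l i \<omega>))"])
    fix j assume j: "j \<in> {1..n}"
    have "(\<lambda>\<omega>. x l \<omega> - \<gamma> *\<^sub>R saga_direction n f j (x l \<omega>) (\<lambda>i. \<phi> l i \<omega>)) \<in> borel_measurable N"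
      by (intro borel_measurable_diff borel_measurable_scaleR borel_measurable_const x
          measurable_saga_direction[OF lip x \<phi> j])
    from measurable_compose[OF this borel_measurable_closest_point[OF K]]
    show "(\<lambda>\<omega>. closest_point K (x l \<omega> - \<gamma> *\<^sub>R saga_direction n f j (x l \<omega>) (\<lambda>i. \<phi> l i \<omega>)))
      \<in> borel_measurable N" .
  qed (use Jl in auto)
  then have 1: "x (Suc l) \<in> borel_measurable N"
    by (subst measurable_cong[OF saga_trajectory_Suc(1)[OF traj]])
  have 2: "\<phi> (Suc l) i \<in> borel_measurable N" if i: "i \<in> {1..n}" for i
  proof -
    have "(\<lambda>\<omega>. ((\<lambda>i. \<phi> l i \<omega>)(J l \<omega> := x l \<omega>)) i) \<in> borel_measurable N"
    proof (rule measurable_compose_countable'[where I = "{1..n}" and g = "J l" and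
          f = "\<lambda>j \<omega>. ((\<lambda>i. \<phi> l i \<omega>)(j := x l \<omega>)) i"])
      fix j show "(\<lambda>\<omega>. ((\<lambda>i. \<phi> l i \<omega>)(j := x l \<omega>)) i) \<in> borel_measurable N"
        using x \<phi>[OF i] by (cases "i = j") auto
    qed (use Jl in auto)
    then show ?thesis
      by (subst measurable_cong[OF saga_trajectory_Suc(2)[OF traj i]])
  qed
  show ?case using 1 2 by blast
qed

section \<open>Conditional descent along the random trajectory\<close>

theorem theorem2p3:
  fixes K :: "(real ^ 'd) set"
    and f :: "nat \<Rightarrow> real ^ 'd \<Rightarrow> real"
    and n k :: nat
    and L \<mu>\<^sub>c \<gamma> c :: real
    and xs x0 :: "real ^ 'd"
    and M :: "'w measure"
    and J :: "nat \<Rightarrow> 'w \<Rightarrow> nat"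
    and x :: "nat \<Rightarrow> 'w \<Rightarrow> real ^ 'd"
    and \<phi> :: "nat \<Rightarrow> nat \<Rightarrow> 'w \<Rightarrow> real ^ 'd"
  assumes "K \<noteq> {}" and "closed K" and "convex K"
    and "n \<ge> 1" and "L > 0"
    and "\<And>i. i \<in> {1..n} \<Longrightarrow> convex_on UNIV (f i)"
    and "\<And>i y. i \<in> {1..n} \<Longrightarrow> f i differentiable (at y)"
    and "\<And>i. i \<in> {1..n} \<Longrightarrow> L-lipschitz_on UNIV (gradient (f i))"
    and "is_arg_min (average n f) (\<lambda>y. y \<in> K) xs"
    and "cone_strong_convexity_parameter K (average n f) xs \<mu>\<^sub>c"
    and "\<gamma> = 1 / (6 * L)"
    and "c = 1 / (\<gamma> * (1 + 4 * \<mu>\<^sub>c * \<gamma>) * real n)"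
    and "prob_space M"
    and "prob_space.indep_vars M (\<lambda>_. count_space {1..n}) J UNIV"
    and "\<And>l. distr M (count_space {1..n}) (J l) = uniform_count_measure {1..n}"
    and "x0 \<in> K"
    and "\<And>\<omega>. \<omega> \<in> space M \<Longrightarrow>
           saga_trajectory K n f \<gamma> x0 (\<lambda>l. J l \<omega>) (\<lambda>l. x l \<omega>) (\<lambda>l i. \<phi> l i \<omega>)"
  shows "AE \<omega> in M.
           real_cond_exp M (saga_sigma M n (x k) (\<phi> k))
             (\<lambda>\<omega>'. saga_lyapunov n f xs c (x (Suc k) \<omega>') (\<lambda>i. \<phi> (Suc k) i \<omega>')) \<omega>
           \<le> (1 - min (1 / (2 * real n)) (\<mu>\<^sub>c / (6 * L)))
             * saga_lyapunov n f xs c (x k \<omega>) (\<lambda>i. \<phi> k i \<omega>)"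
proof -
  note K = assms(2,3,1) and n = assms(4) and L = assms(5) and conv = assms(6) and diff = assms(7)
    and lip = assms(8) and argmin = assms(9) and x0 = assms(16) and traj = assms(17)
  interpret prob_space M by fact
  have J_meas: "J l \<in> measurable M (count_space {1..n})" for l
    using assms(14) by (simp add: indep_vars_def)
  define S where "S = (\<lambda>\<omega>. (x k \<omega>, \<lambda>i\<in>{1..n}. \<phi> k i \<omega>))"
  define P where "P = (\<lambda>\<omega>. restrict (\<lambda>l. J l \<omega>) {..<k})"
  \<comment> \<open>The sigma-algebra of the past indices; it lies between \<open>F\<close> and
    \<open>M\<close>, which carries independence over to \<open>F\<close>.\<close>
  define N where "N = vimage_algebra (space M) P (PiM {..<k} (\<lambda>_. count_space {1..n}))"
  define F where "F = saga_sigma M n (x k) (\<phi> k)"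
  have P_meas: "P \<in> measurable M (PiM {..<k} (\<lambda>_. count_space {1..n}))"
    unfolding P_def by (intro measurable_restrict J_meas)
  then have P_space: "P \<in> space M \<rightarrow> space (PiM {..<k} (\<lambda>_. count_space {1..n}))"
    by (auto dest: measurable_space)
  have space_N: "space N = space M"
    by (simp add: N_def)
  have JN: "J l \<in> measurable N (count_space {1..n})" if "l < k" for l
  proof -
    have "(\<lambda>\<omega>. P \<omega> l) \<in> measurable N (count_space {1..n})"
      unfolding N_def using that
      by (intro measurable_compose[OF measurable_vimage_algebra1[OF P_space]] measurable_component_singleton) auto
    then show ?thesis
      using that by (simp add: P_def)
  qed
  have state_N: "x k \<in> borel_measurable N \<and> (\<forall>i\<in>{1..n}. \<phi> k i \<in> borel_measurable N)"
    by (rule measurable_saga_state[where J = J, OF K lip JN]) (use traj space_N in auto)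
  have S_space: "S \<in> space M \<rightarrow> space (borel \<Otimes>\<^sub>M (\<Pi>\<^sub>M i\<in>{1..n}. borel))"
    by (auto simp: S_def space_pair_measure space_PiM)
  have F_eq: "F = vimage_algebra (space M) S (borel \<Otimes>\<^sub>M (\<Pi>\<^sub>M i\<in>{1..n}. borel))"
    by (simp add: F_def S_def saga_sigma_def)
  have S_F: "S \<in> measurable F (borel \<Otimes>\<^sub>M (\<Pi>\<^sub>M i\<in>{1..n}. borel))"
    unfolding F_eq by (rule measurable_vimage_algebra1[OF S_space])
  have x_F: "x k \<in> borel_measurable F"
    using measurable_compose[OF S_F measurable_fst] by (simp add: S_def)
  have \<phi>_F: "\<phi> k i \<in> borel_measurable F" if "i \<in> {1..n}" for i
    using measurable_compose[OF measurable_compose[OF S_F measurable_snd] measurable_component_singleton[OF that]]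
      that by (simp add: S_def)
  have "S \<in> measurable N (borel \<Otimes>\<^sub>M (\<Pi>\<^sub>M i\<in>{1..n}. borel))"
    unfolding S_def using state_N by (intro measurable_Pair measurable_restrict) auto
  then have FN: "sets F \<subseteq> sets N"
    unfolding F_eq sets_vimage_algebra2[OF S_space] by (auto simp: space_N[symmetric] dest: measurable_sets)
  have NM: "sets N \<subseteq> sets M"
    unfolding N_def sets_vimage_algebra2[OF P_space] using P_meas by (auto dest: measurable_sets)
  have F_sub: "subalgebra M F"
    using FN NM by (auto simp: subalgebra_def F_eq)
  have prob_J: "prob (J k -` {i} \<inter> space M) = 1 / real n" if "i \<in> {1..n}" for i
  proof -
    have "prob (J k -` {i} \<inter> space M) = measure (distr M (count_space {1..n}) (J k)) {i}"
      using that by (intro measure_distr[symmetric] J_meas) auto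
    also have "\<dots> = 1 / real n"
      using that unfolding assms(15) by (subst measure_uniform_count_measure) auto
    finally show ?thesis .
  qed
  have indep: "prob (A \<inter> (J k -` {i} \<inter> space M)) = prob A * (1 / real n)"
    if A: "A \<in> sets F" and i: "i \<in> {1..n}" for A i
  proof -
    define Q where "Q = (\<lambda>\<omega>. restrict (\<lambda>l. J l \<omega>) {k})"
    \<comment> \<open>The index sets \<open>{..<k}\<close> and \<open>{k}\<close> are disjoint, so
      the past is independent of the current draw.\<close>
    have "indep_var (PiM {..<k} (\<lambda>_. count_space {1..n})) P (PiM {k} (\<lambda>_. count_space {1..n})) Q"
      unfolding P_def Q_def by (rule indep_var_restrict[OF assms(14)]) auto
    then have *: "indep_set
        (sigma_sets (space M) {P -` A \<inter> space M |A. A \<in> sets (PiM {..<k} (\<lambda>_. count_space {1..n}))})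
        (sigma_sets (space M) {Q -` A \<inter> space M |A. A \<in> sets (PiM {k} (\<lambda>_. count_space {1..n}))})"
      unfolding indep_var_eq by blast
    have "A \<in> sigma_sets (space M)
        {P -` A \<inter> space M |A. A \<in> sets (PiM {..<k} (\<lambda>_. count_space {1..n}))}"
      using A FN by (auto simp: N_def sets_vimage_algebra)
    moreover have "J k -` {i} \<inter> space M \<in> sigma_sets (space M)
        {Q -` A \<inter> space M |A. A \<in> sets (PiM {k} (\<lambda>_. count_space {1..n}))}"
    proof -
      have "J k -` {i} \<inter> space M = Q -` (\<Pi>\<^sub>E l\<in>{k}. {i}) \<inter> space M"
        by (simp only: Q_def restrict_PiE_iff vimage_def mem_Collect_eq) simp
      moreover have "(\<Pi>\<^sub>E l\<in>{k}. {i}) \<in> sets (PiM {k} (\<lambda>_. count_space {1..n}))"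
        using i by (intro sets_PiM_I_finite) auto
      ultimately show ?thesis
        by (intro sigma_sets.Basic) blast
    qed
    ultimately show ?thesis
      using indep_setD[OF *] prob_J[OF i] by simp
  qed
  define T where "T = (\<lambda>j \<omega>. saga_step_lyapunov K n f xs \<gamma> c j (x k \<omega>) (\<lambda>i. \<phi> k i \<omega>))"
  have T_F: "T j \<in> borel_measurable F" if "j \<in> {1..n}" for j
    unfolding T_def by (rule measurable_saga_step_lyapunov[OF K diff lip x_F \<phi>_F that])
  have T_int: "integrable M (T j)" if j: "j \<in> {1..n}" for j
  proof -
    have TN: "T j \<in> borel_measurable N"
      by (rule measurable_from_subalg[OF _ T_F[OF j]]) (use FN in \<open>simp add: subalgebra_def F_eq space_N\<close>)
    \<comment> \<open>Only finitely many index histories of length \<open>k\<close> exist, and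
      \<open>T j\<close> is a function of the history, so it is bounded.\<close>
    have "P ` space M \<subseteq> (\<Pi>\<^sub>E l\<in>{..<k}. {1..n})"
      using P_space by (auto simp: space_PiM)
    then have "finite (P ` space M)"
      by (rule finite_subset) (intro finite_PiE, auto)
    then have fin: "finite (T j ` space M)"
      using TN P_space unfolding N_def by (intro finite_image_vimage_algebra)
    have "norm (T j \<omega>) \<le> Max ((\<lambda>t. norm t) ` T j ` space M)" if "\<omega> \<in> space M" for \<omega>
      using that fin by (intro Max_ge) auto
    then show ?thesis
      using measurable_from_subalg[OF F_sub T_F[OF j]] by (intro integrable_const_bound AE_I2) auto
  qed
  have step: "saga_lyapunov n f xs c (x (Suc k) \<omega>) (\<lambda>i. \<phi> (Suc k) i \<omega>) = T (J k \<omega>) \<omega>"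
    if "\<omega> \<in> space M" for \<omega>
    unfolding T_def saga_step_lyapunov_def saga_trajectory_Suc(1)[OF traj[OF that]]
    by (intro saga_lyapunov_cong saga_trajectory_Suc(2)[OF traj[OF that]])
  have descent: "(\<Sum>j\<in>{1..n}. 1 / real n * T j \<omega>)
      \<le> (1 - min (1 / (2 * real n)) (\<mu>\<^sub>c / (6 * L))) * saga_lyapunov n f xs c (x k \<omega>) (\<lambda>i. \<phi> k i \<omega>)"
    if \<omega>: "\<omega> \<in> space M" for \<omega>
    unfolding T_def
  proof (rule saga_descent[OF K(1,2) n L conv diff lip argmin _ assms(11,12)])
    show "cone_strong_convexity_const K (average n f) xs \<mu>\<^sub>c"
      using assms(10) by (simp add: cone_strong_convexity_parameter_def)
    show "x k \<omega> \<in> K"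
      by (rule saga_trajectory_in_set[OF traj[OF \<omega>] K(1) x0])
  qed
  have "AE \<omega> in M. real_cond_exp M F (\<lambda>\<omega>. T (J k \<omega>) \<omega>) \<omega> = (\<Sum>j\<in>{1..n}. 1 / real n * T j \<omega>)"
    by (rule real_cond_exp_random_index[OF F_sub _ J_meas indep T_F T_int]) auto
  moreover have "AE \<omega> in M. real_cond_exp M F
      (\<lambda>\<omega>'. saga_lyapunov n f xs c (x (Suc k) \<omega>') (\<lambda>i. \<phi> (Suc k) i \<omega>')) \<omega>
      = real_cond_exp M F (\<lambda>\<omega>. T (J k \<omega>) \<omega>) \<omega>"
  proof -
    interpret finite_measure_subalgebra M F
      by standard (rule F_sub)
    have TJ: "(\<lambda>\<omega>. T (J k \<omega>) \<omega>) \<in> borel_measurable M"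
      using J_meas[of k] measurable_from_subalg[OF F_sub T_F]
      by (intro measurable_compose_countable'[where I = "{1..n}" and g = "J k" and f = T]) auto
    moreover from TJ have "(\<lambda>\<omega>'. saga_lyapunov n f xs c (x (Suc k) \<omega>') (\<lambda>i. \<phi> (Suc k) i \<omega>'))
        \<in> borel_measurable M"
      by (subst measurable_cong[OF step])
    ultimately show ?thesis
      by (intro real_cond_exp_cong AE_I2 step)
  qed
  \<comment> \<open>Supplies the membership in \<open>space M\<close> under which
    \<open>descent\<close> holds.\<close>
  moreover note AE_space[of M]
  ultimately show ?thesis
    unfolding F_def[symmetric] by eventually_elim (use descent in simp)
qed

end
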